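(* Let $\mathcal{H}$ be a complex Hilbert space, let $a,b,x,y\in\mathcal{H}$ and let $\lambda\in[-1,1]$. Then \[ \left|\langle a,y\rangle\,\langle\sqrt{1-\lambda^2}\,x+\lambda y,\,b\rangle\right|\leq\frac{\|a\|\,\|b\|+|\lambda|\,|\langle a,b\rangle|}{2}\left(\|x\|^2+\|y\|^2\right). \]
   Context: The inner product $\langle\cdot,\cdot\rangle$ of $\mathcal{H}$ is linear in the first argument, and $\|\cdot\|$ is the induced norm. *)

theory Defs
  imports "HOL-Analysis.Analysis"
begin

text \<open>
  The libraries only provide real inner product spaces. A complex one is presented as a
  real normed vector space together with a complex scalar multiplication extending the real one
  and an inner product that induces the given norm. The real structure, the norm and the topology
  are thus all determined by the complex structure.
\<close>

class complex_inner = real_normed_vector +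
  fixes scaleC :: "complex \<Rightarrow> 'a \<Rightarrow> 'a" (infixr \<open>*\<^sub>C\<close> 75)
    and cinner :: "'a \<Rightarrow> 'a \<Rightarrow> complex" (\<open>\<langle>_, _\<rangle>\<close>)
  assumes scaleC_add_right: "c *\<^sub>C (x + y) = c *\<^sub>C x + c *\<^sub>C y"
    and scaleC_add_left: "(c + d) *\<^sub>C x = c *\<^sub>C x + d *\<^sub>C x"
    and scaleC_scaleC: "c *\<^sub>C d *\<^sub>C x = (c * d) *\<^sub>C x"
    and scaleC_one: "1 *\<^sub>C x = x"
    and scaleR_eq_scaleC: "r *\<^sub>R x = complex_of_real r *\<^sub>C x"
    and cinner_add_left: "\<langle>x + y, z\<rangle> = \<langle>x, z\<rangle> + \<langle>y, z\<rangle>"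
    and cinner_scaleC_left: "\<langle>c *\<^sub>C x, y\<rangle> = c * \<langle>x, y\<rangle>"
    and cinner_commute: "\<langle>x, y\<rangle> = cnj \<langle>y, x\<rangle>"
    and cinner_ge_zero: "0 \<le> Re \<langle>x, x\<rangle>"
    and cinner_eq_zero_iff: "\<langle>x, x\<rangle> = 0 \<longleftrightarrow> x = 0"
    and norm_eq_sqrt_cinner: "norm x = sqrt (Re \<langle>x, x\<rangle>)"

class complex_hilbert_space = complex_inner + complete_space

instantiation complex :: complex_hilbert_space
begin

definition scaleC_complex :: "complex \<Rightarrow> complex \<Rightarrow> complex"
  where "scaleC_complex c z = c * z"

definition cinner_complex :: "complex \<Rightarrow> complex \<Rightarrow> complex"
  where "cinner_complex z w = z * cnj w"

instance
proof
  fix z :: complex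
  show "norm z = sqrt (Re \<langle>z, z\<rangle>)"
    by (simp add: cinner_complex_def cmod_def power2_eq_square)
qed (auto simp: scaleC_complex_def cinner_complex_def scaleR_conv_of_real algebra_simps)

end

end

theory Submission
  imports Defs
begin

text \<open>
  The inequality is Buzano's inequality
  \<open>2 |\<langle>u, w\<rangle> \<langle>w, v\<rangle>| \<le> (\<parallel>u\<parallel> \<parallel>v\<parallel> + |\<langle>u, v\<rangle>|) \<parallel>w\<parallel>\<^sup>2\<close> in the orthogonal sum of two
  copies of the space. For \<open>l \<in> [-1, 1]\<close> put \<open>s = sqrt (1 - l\<^sup>2)\<close> and take there
  \<open>w = (x, y)\<close>, \<open>u = (0, a)\<close> and \<open>v = (s b, l b)\<close>. Then \<open>\<langle>u, w\<rangle> = \<langle>a, y\<rangle>\<close> and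
  \<open>\<langle>w, v\<rangle> = \<langle>s x + l y, b\<rangle>\<close>, while \<open>\<parallel>u\<parallel> = \<parallel>a\<parallel>\<close>, \<open>\<parallel>v\<parallel> = \<parallel>b\<parallel>\<close> because \<open>s\<^sup>2 + l\<^sup>2 = 1\<close>,
  \<open>\<langle>u, v\<rangle> = l \<langle>a, b\<rangle>\<close> and \<open>\<parallel>w\<parallel>\<^sup>2 = \<parallel>x\<parallel>\<^sup>2 + \<parallel>y\<parallel>\<^sup>2\<close>.

  Buzano's inequality in turn is the Cauchy-Schwarz inequality for the reflection of \<open>u\<close> in the
  line through \<open>w\<close>: for a unit vector \<open>w\<close> this reflection is \<open>2 \<langle>u, w\<rangle> w - u\<close>, it has the
  norm of \<open>u\<close>, and its inner product with \<open>v\<close> is \<open>2 \<langle>u, w\<rangle> \<langle>w, v\<rangle> - \<langle>u, v\<rangle>\<close>.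
\<close>

lemma cinner_scaleC_right: "\<langle>x, c *\<^sub>C y\<rangle> = cnj c * \<langle>x, y :: 'a::complex_inner\<rangle>"
  by (metis cinner_scaleC_left cinner_commute complex_cnj_mult)

lemma cinner_zero_left [simp]: "\<langle>0, y :: 'a::complex_inner\<rangle> = 0"
  using cinner_add_left[of 0 0 y] by simp

lemma cinner_minus_left: "\<langle>- x, y\<rangle> = - \<langle>x, y :: 'a::complex_inner\<rangle>"
  using cinner_add_left[of x "- x" y] by (simp add: add_eq_0_iff)

lemma cinner_diff_left: "\<langle>x - y, z\<rangle> = \<langle>x, z\<rangle> - \<langle>y, z :: 'a::complex_inner\<rangle>"
  using cinner_add_left[of x "- y" z] by (simp add: cinner_minus_left)

lemma cinner_diff_right: "\<langle>x, y - z\<rangle> = \<langle>x, y\<rangle> - \<langle>x, z :: 'a::complex_inner\<rangle>"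
  by (metis cinner_diff_left cinner_commute complex_cnj_diff)

lemma cinner_self: "\<langle>x, x\<rangle> = complex_of_real ((norm (x :: 'a::complex_inner))\<^sup>2)"
proof (rule complex_eqI)
  show "Re \<langle>x, x\<rangle> = Re (complex_of_real ((norm x)\<^sup>2))"
    by (simp add: norm_eq_sqrt_cinner cinner_ge_zero)
  have "Im \<langle>x, x\<rangle> = - Im \<langle>x, x\<rangle>"
    using arg_cong[OF cinner_commute[of x x], of Im] by simp
  then show "Im \<langle>x, x\<rangle> = Im (complex_of_real ((norm x)\<^sup>2))"
    by simp
qed

lemma cinner_mult_swap: "\<langle>x, y\<rangle> * \<langle>y, x :: 'a::complex_inner\<rangle> = complex_of_real ((cmod \<langle>x, y\<rangle>)\<^sup>2)"
  by (metis cinner_commute complex_norm_square)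

text \<open>
  The square of the norm of \<open>\<parallel>y\<parallel>\<^sup>2 x - \<langle>x, y\<rangle> y\<close>, which is \<open>\<parallel>y\<parallel>\<^sup>2\<close> times the component of
  \<open>x\<close> orthogonal to \<open>y\<close>, is nonnegative.
\<close>

lemma cmod_cinner_le_norm:
  fixes x y :: "'a::complex_inner"
  shows "cmod \<langle>x, y\<rangle> \<le> norm x * norm y"
proof (cases "y = 0")
  case True
  then show ?thesis
    by (metis cinner_commute cinner_zero_left complex_cnj_zero norm_zero mult_zero_right order_refl)
next
  case False
  define n where "n = complex_of_real ((norm y)\<^sup>2)"
  define z where "z = n *\<^sub>C x - \<langle>x, y\<rangle> *\<^sub>C y"
  have "\<langle>z, z\<rangle> = n * n * \<langle>x, x\<rangle> - n * (\<langle>x, y\<rangle> * \<langle>y, x\<rangle>)"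
    using cinner_commute[of y x] cinner_self[of y]
    by (simp add: z_def cinner_diff_left cinner_diff_right cinner_scaleC_left cinner_scaleC_right
        n_def algebra_simps)
  also have "\<dots> = complex_of_real ((norm y)\<^sup>2 * ((norm x * norm y)\<^sup>2 - (cmod \<langle>x, y\<rangle>)\<^sup>2))"
    unfolding cinner_self[of x] cinner_mult_swap by (simp add: n_def algebra_simps power_mult_distrib)
  finally have "0 \<le> (norm y)\<^sup>2 * ((norm x * norm y)\<^sup>2 - (cmod \<langle>x, y\<rangle>)\<^sup>2)"
    using cinner_ge_zero[of z] by simp
  then have "(cmod \<langle>x, y\<rangle>)\<^sup>2 \<le> (norm x * norm y)\<^sup>2"
    using False by (simp add: zero_le_mult_iff)
  then show ?thesis
    by (rule power2_le_imp_le) simp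
qed

text \<open>
  The vector \<open>r\<close> is \<open>\<parallel>w\<parallel>\<^sup>2\<close> times the reflection of \<open>u\<close> in the line through \<open>w\<close>; the scaling
  avoids a division by \<open>\<parallel>w\<parallel>\<close>.
\<close>

theorem Buzano_inequality:
  fixes u v w :: "'a::complex_inner"
  shows "cmod (\<langle>u, w\<rangle> * \<langle>w, v\<rangle>) \<le> (norm u * norm v + cmod \<langle>u, v\<rangle>) / 2 * (norm w)\<^sup>2"
proof -
  define n where "n = complex_of_real ((norm w)\<^sup>2)"
  define r where "r = (2 * \<langle>u, w\<rangle>) *\<^sub>C w - n *\<^sub>C u"
  have "\<langle>r, r\<rangle> = n * n * \<langle>u, u\<rangle>"
    using cinner_commute[of w u] cinner_self[of w]
    by (simp add: r_def cinner_diff_left cinner_diff_right cinner_scaleC_left cinner_scaleC_right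
        n_def algebra_simps)
  also have "\<dots> = complex_of_real (((norm w)\<^sup>2 * norm u)\<^sup>2)"
    unfolding cinner_self[of u] by (simp add: n_def algebra_simps power2_eq_square)
  finally have norm_r: "norm r = (norm w)\<^sup>2 * norm u"
    by (simp add: norm_eq_sqrt_cinner[of r])
  have "2 * (\<langle>u, w\<rangle> * \<langle>w, v\<rangle>) = \<langle>r, v\<rangle> + n * \<langle>u, v\<rangle>"
    by (simp add: r_def cinner_diff_left cinner_scaleC_left)
  then have "2 * cmod (\<langle>u, w\<rangle> * \<langle>w, v\<rangle>) = cmod (\<langle>r, v\<rangle> + n * \<langle>u, v\<rangle>)"
    by (metis norm_mult norm_numeral)
  also have "\<dots> \<le> cmod \<langle>r, v\<rangle> + cmod (n * \<langle>u, v\<rangle>)"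
    by (rule norm_triangle_ineq)
  also have "\<dots> \<le> norm r * norm v + (norm w)\<^sup>2 * cmod \<langle>u, v\<rangle>"
    using cmod_cinner_le_norm[of r v] by (simp add: n_def norm_mult norm_power)
  finally show ?thesis
    by (simp add: norm_r algebra_simps)
qed

text \<open>
  The inner product of the orthogonal sum has to induce the norm that pairs already carry, which
  is the Euclidean one.
\<close>

instantiation prod :: (complex_inner, complex_inner) complex_inner
begin

definition scaleC_prod :: "complex \<Rightarrow> 'a \<times> 'b \<Rightarrow> 'a \<times> 'b"
  where "scaleC_prod c p = (c *\<^sub>C fst p, c *\<^sub>C snd p)"

definition cinner_prod :: "'a \<times> 'b \<Rightarrow> 'a \<times> 'b \<Rightarrow> complex"
  where "cinner_prod p q = \<langle>fst p, fst q\<rangle> + \<langle>snd p, snd q\<rangle>"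

instance
proof
  fix c d :: complex and r :: real and p q t :: "'a \<times> 'b"
  show "c *\<^sub>C (p + q) = c *\<^sub>C p + c *\<^sub>C q"
    by (simp add: scaleC_prod_def scaleC_add_right)
  show "(c + d) *\<^sub>C p = c *\<^sub>C p + d *\<^sub>C p"
    by (simp add: scaleC_prod_def scaleC_add_left)
  show "c *\<^sub>C d *\<^sub>C p = (c * d) *\<^sub>C p"
    by (simp add: scaleC_prod_def scaleC_scaleC)
  show "1 *\<^sub>C p = p"
    by (simp add: scaleC_prod_def scaleC_one)
  show "r *\<^sub>R p = complex_of_real r *\<^sub>C p"
    by (simp add: scaleC_prod_def scaleR_prod_def scaleR_eq_scaleC)
  show "\<langle>p + q, t\<rangle> = \<langle>p, t\<rangle> + \<langle>q, t\<rangle>"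
    by (simp add: cinner_prod_def cinner_add_left)
  show "\<langle>c *\<^sub>C p, q\<rangle> = c * \<langle>p, q\<rangle>"
    by (simp add: cinner_prod_def scaleC_prod_def cinner_scaleC_left distrib_left)
  show "\<langle>p, q\<rangle> = cnj \<langle>q, p\<rangle>"
    by (simp add: cinner_prod_def cinner_commute[of "fst p"] cinner_commute[of "snd p"])
  have self: "\<langle>p, p\<rangle> = complex_of_real ((norm (fst p))\<^sup>2 + (norm (snd p))\<^sup>2)"
    by (simp add: cinner_prod_def cinner_self)
  then show "0 \<le> Re \<langle>p, p\<rangle>"
    by simp
  show "norm p = sqrt (Re \<langle>p, p\<rangle>)"
    unfolding self by (simp add: norm_prod_def)
  show "\<langle>p, p\<rangle> = 0 \<longleftrightarrow> p = 0"
    unfolding self of_real_eq_0_iff by (simp add: sum_power2_eq_zero_iff prod_eq_iff)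
qed

end

theorem lemma2p2:
  fixes a b x y :: "'h::complex_hilbert_space" and l :: real
  assumes "l \<in> {-1..1}"
  shows "cmod (\<langle>a, y\<rangle> * \<langle>complex_of_real (sqrt (1 - l\<^sup>2)) *\<^sub>C x + complex_of_real l *\<^sub>C y, b\<rangle>)
    \<le> (norm a * norm b + \<bar>l\<bar> * cmod \<langle>a, b\<rangle>) / 2 * ((norm x)\<^sup>2 + (norm y)\<^sup>2)"
proof -
  define s where "s = sqrt (1 - l\<^sup>2)"
  define u v w :: "'h \<times> 'h" where "u = (0, a)" and "v = (s *\<^sub>R b, l *\<^sub>R b)" and "w = (x, y)"
  have "l\<^sup>2 \<le> 1"
    using assms by (simp add: abs_square_le_1 abs_le_iff)
  then have s_sq: "s\<^sup>2 + l\<^sup>2 = 1"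
    by (simp add: s_def)
  have "(norm v)\<^sup>2 = (s\<^sup>2 + l\<^sup>2) * (norm b)\<^sup>2"
    by (simp add: v_def norm_prod_def power_mult_distrib distrib_right)
  then have "norm v = norm b"
    by (simp add: s_sq)
  moreover have "norm u = norm a" "(norm w)\<^sup>2 = (norm x)\<^sup>2 + (norm y)\<^sup>2"
    by (simp_all add: u_def w_def norm_prod_def)
  moreover have "\<langle>u, w\<rangle> = \<langle>a, y\<rangle>"
    by (simp add: u_def w_def cinner_prod_def)
  moreover have "\<langle>w, v\<rangle> = \<langle>complex_of_real s *\<^sub>C x + complex_of_real l *\<^sub>C y, b\<rangle>"
    by (simp add: v_def w_def cinner_prod_def scaleR_eq_scaleC cinner_add_left
        cinner_scaleC_left cinner_scaleC_right)
  moreover have "cmod \<langle>u, v\<rangle> = \<bar>l\<bar> * cmod \<langle>a, b\<rangle>"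
    by (simp add: u_def v_def cinner_prod_def scaleR_eq_scaleC cinner_scaleC_right norm_mult)
  ultimately show ?thesis
    using Buzano_inequality[of u w v] by (simp add: s_def)
qed

end
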